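(* Let $y_0,\zeta\in\mathbb{R}^n$, $y_\zeta=y_0+\zeta$, $\lambda>0$, let $p_{\lambda,\zeta}\in\mathbb{R}^n$ be the solution of the dual training problem $(D_\lambda)$, and let $\eta_{\lambda,\zeta}=K_*p_{\lambda,\zeta}$. Fix $\pi\in\{0,1\}^n$ and $J\subset I$, and set $$z_{\lambda,\zeta}:=\sum_{i\in J}p_{\lambda,\zeta}^i\pi_ix^i,\qquad \tilde z_{\lambda,\zeta}:=P_{L^J}z_{\lambda,\zeta}.$$ If there exists $w_{\lambda,\zeta}\in R_\pi^J\cap\mathbb{S}^{d-1}$ such that $|\eta_{\lambda,\zeta}(w_{\lambda,\zeta})|=1$, then $\tilde z_{\lambda,\zeta}\ne0$ and $$w_{\lambda,\zeta}=\operatorname{sign}(\eta_{\lambda,\zeta}(w_{\lambda,\zeta}))\,\frac{\tilde z_{\lambda,\zeta}}{\|\tilde z_{\lambda,\zeta}\|}.$$ Moreover, $|\eta_{\lambda,\zeta}(w)|<1$ for every $w\in\big(\overline{R}_\pi^J\cap\mathbb{S}^{d-1}\big)\setminus\{w_{\lambda,\zeta}\}$.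
   Context: Setting. $d,n$ are positive integers, $x^1,\dots,x^n\in\mathbb{R}^d\setminus\{0\}$ are given data points, $I=\{1,\dots,n\}$, and $\sigma(z)=\max\{0,z\}$ is the ReLU function. $K_*:\mathbb{R}^n\to C(\mathbb{S}^{d-1})$ is $K_*p(w)=\sum_{j=1}^np^j\sigma(\langle w,x^j\rangle)$. The dual training problem $(D_\lambda)$ is: maximize $\langle y_\zeta,p\rangle-\frac\lambda2\|p\|^2$ over $p\in\mathbb{R}^n$ with $\|K_*p\|_\infty=\sup_{w\in\mathbb{S}^{d-1}}|K_*p(w)|\le1$; it has a unique solution. Dual regions (strata). For $i\in I$ let $H_i=\{w\in\mathbb{R}^d:\langle w,x^i\rangle=0\}$, $A_i^1=\{w\in\mathbb{R}^d:\langle w,x^i\rangle>0\}$, $A_i^0=\{w\in\mathbb{R}^d:\langle w,x^i\rangle<0\}$. For $\pi\in\{0,1\}^n$ and $J\subset I$, $$R_\pi^J:=\Big(\bigcap_{j\in J}A_j^{\pi_j}\Big)\cap\Big(\bigcap_{z\in I\setminus J}H_z\Big),\qquad L^J:=\bigcap_{z\in I\setminus J}H_z$$ (so $L^I=\mathbb{R}^d$). $\overline R_\pi^J$ is the closure of $R_\pi^J$ in the relative topology of $L^J$, and $P_{L^J}$ is the orthogonal projection of $\mathbb{R}^d$ onto $L^J$. *)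

theory Defs
  imports "HOL-Analysis.Analysis"
begin

text \<open>
  The index set is the finite type \<open>'n\<close>, so the set of all indices is \<^term>\<open>UNIV\<close>, and
  activation patterns in $\{0,1\}^n$ are functions \<open>'n \<Rightarrow> bool\<close> (coerced to numbers by
  \<^const>\<open>of_bool\<close>).
\<close>

definition relu :: "real \<Rightarrow> real" where
  "relu t = max 0 t"

text \<open>The continuous function on the unit sphere is the restriction of the following
  function, which is defined on the whole space.\<close>

definition Kstar :: "('n::finite \<Rightarrow> real ^ 'd::finite) \<Rightarrow> real ^ 'n \<Rightarrow> real ^ 'd \<Rightarrow> real" where
  "Kstar x p w = (\<Sum>j\<in>UNIV. p $ j * relu (w \<bullet> x j))"

definition sphere_norm :: "(real ^ 'd::finite \<Rightarrow> real) \<Rightarrow> real" where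
  "sphere_norm f = (SUP w\<in>sphere 0 1. \<bar>f w\<bar>)"

text \<open>The problem has exactly one solution when \<open>lam > 0\<close>: the objective is strongly concave
  and continuous, and the feasible set is closed, convex and contains \<open>0\<close>.\<close>

definition dual_solution ::
    "('n::finite \<Rightarrow> real ^ 'd::finite) \<Rightarrow> real ^ 'n \<Rightarrow> real \<Rightarrow> real ^ 'n \<Rightarrow> bool" where
  "dual_solution x y lam p \<longleftrightarrow>
     is_arg_max (\<lambda>q. y \<bullet> q - lam / 2 * (norm q)\<^sup>2) (\<lambda>q. sphere_norm (Kstar x q) \<le> 1) p"

definition hyperplane :: "('n \<Rightarrow> real ^ 'd::finite) \<Rightarrow> 'n \<Rightarrow> (real ^ 'd) set" where
  "hyperplane x i = {w. w \<bullet> x i = 0}"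

definition halfspace :: "('n \<Rightarrow> real ^ 'd::finite) \<Rightarrow> bool \<Rightarrow> 'n \<Rightarrow> (real ^ 'd) set" where
  "halfspace x b i = (if b then {w. w \<bullet> x i > 0} else {w. w \<bullet> x i < 0})"

definition flat :: "('n \<Rightarrow> real ^ 'd::finite) \<Rightarrow> 'n set \<Rightarrow> (real ^ 'd) set" where
  "flat x J = (\<Inter>z\<in>UNIV - J. hyperplane x z)"

definition stratum ::
    "('n \<Rightarrow> real ^ 'd::finite) \<Rightarrow> ('n \<Rightarrow> bool) \<Rightarrow> 'n set \<Rightarrow> (real ^ 'd) set" where
  "stratum x \<pi> J = (\<Inter>j\<in>J. halfspace x (\<pi> j) j) \<inter> (\<Inter>z\<in>UNIV - J. hyperplane x z)"

definition stratum_closure ::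
    "('n \<Rightarrow> real ^ 'd::finite) \<Rightarrow> ('n \<Rightarrow> bool) \<Rightarrow> 'n set \<Rightarrow> (real ^ 'd) set" where
  "stratum_closure x \<pi> J = top_of_set (flat x J) closure_of stratum x \<pi> J"

definition orth_proj :: "'a::euclidean_space set \<Rightarrow> 'a \<Rightarrow> 'a" where
  "orth_proj S z = (THE u. u \<in> S \<and> (\<forall>v\<in>S. orthogonal (z - u) v))"

lemma orth_proj_ex1:
  fixes S :: "'a::euclidean_space set"
  assumes "subspace S"
  shows "\<exists>!u. u \<in> S \<and> (\<forall>v\<in>S. orthogonal (z - u) v)"
proof (rule ex_ex1I)
  obtain u v where uv: "u \<in> span S" "\<And>w. w \<in> span S \<Longrightarrow> orthogonal v w" "z = u + v"
    using orthogonal_subspace_decomp_exists [of S z] by metis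
  have "span S = S"
    using assms by (simp add: span_eq_iff)
  with uv show "\<exists>u. u \<in> S \<and> (\<forall>v\<in>S. orthogonal (z - u) v)"
    by (intro exI [of _ u]) auto
next
  fix u u'
  assume u: "u \<in> S \<and> (\<forall>v\<in>S. orthogonal (z - u) v)"
    and u': "u' \<in> S \<and> (\<forall>v\<in>S. orthogonal (z - u') v)"
  then have "u - u' \<in> S"
    using assms by (simp add: subspace_diff)
  with u u' have "(z - u) \<bullet> (u - u') = 0" "(z - u') \<bullet> (u - u') = 0"
    by (simp_all add: orthogonal_def)
  then have "((z - u') - (z - u)) \<bullet> (u - u') = 0"
    by (subst inner_diff_left) simp
  then show "u = u'"
    by simp
qed

lemma subspace_flat: "subspace (flat x J)"
  unfolding flat_def hyperplane_def
  by (auto simp: subspace_def inner_add_left)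

end

theory Submission
  imports Defs
begin

text \<open>
  On the closed stratum, \<open>\<eta>\<close> is the linear functional \<open>v \<mapsto> zt \<bullet> v\<close>, and feasibility of \<open>p\<close>
  bounds \<open>\<bar>\<eta>\<bar>\<close> by 1 on the sphere. The stratum is a relatively open cone in the flat, so \<open>w\<close>
  can be moved in the direction \<open>\<plusminus>zt\<close> without leaving it; the bound at the moved point forces
  \<open>norm zt \<le> 1\<close>, while Cauchy-Schwarz at \<open>w\<close> gives \<open>norm zt \<ge> 1\<close>. Hence \<open>w = \<plusminus>zt\<close>. The only
  other unit vector where \<open>\<bar>zt \<bullet> v\<bar> = 1\<close> is \<open>- w\<close>, which lies outside the closed stratum
  unless \<open>J = {}\<close>; in that case \<open>\<eta>\<close> vanishes on the flat.
\<close>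

lemma orth_proj_props:
  assumes "subspace S"
  shows orth_proj_in: "orth_proj S z \<in> S"
    and inner_orth_proj: "v \<in> S \<Longrightarrow> orth_proj S z \<bullet> v = z \<bullet> v"
  using theI' [OF orth_proj_ex1 [OF assms, of z]]
  by (auto simp: orth_proj_def orthogonal_def inner_diff_left)

lemma continuous_on_Kstar: "continuous_on S (Kstar x p)"
  unfolding Kstar_def relu_def by (intro continuous_intros)

text \<open>A supremum of reals is an upper bound only when the set is bounded above; compactness of
  the sphere and continuity supply this.\<close>

lemma abs_le_sphere_norm:
  assumes "continuous_on (sphere 0 1) f" "v \<in> sphere 0 1"
  shows "\<bar>f v\<bar> \<le> sphere_norm f"
proof -
  have "compact ((\<lambda>w. \<bar>f w\<bar>) ` sphere 0 1)"
    using assms(1) by (intro compact_continuous_image continuous_intros compact_sphere)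
  then show ?thesis
    unfolding sphere_norm_def
    by (intro cSUP_upper assms bounded_imp_bdd_above compact_imp_bounded)
qed

lemma Kstar_scaleR:
  assumes "c \<ge> 0"
  shows "Kstar x p (c *\<^sub>R v) = c * Kstar x p v"
proof -
  have "relu (c * t) = c * relu t" for t
    using assms by (simp add: relu_def max_def mult_le_0_iff zero_le_mult_iff)
  then show ?thesis
    by (simp add: Kstar_def sum_distrib_left mult.left_commute)
qed

text \<open>Feasibility speaks only of unit vectors. Positive homogeneity carries the bound to all
  vectors, so that it can be tested at points moved off the sphere.\<close>

lemma abs_Kstar_le_norm:
  assumes "sphere_norm (Kstar x p) \<le> 1"
  shows "\<bar>Kstar x p v\<bar> \<le> norm v"
proof (cases "v = 0")
  case True
  then show ?thesis by (simp add: Kstar_def relu_def)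
next
  case False
  have "\<bar>Kstar x p (sgn v)\<bar> \<le> 1"
    using abs_le_sphere_norm [OF continuous_on_Kstar, of "sgn v" x p] assms False
    by (simp add: norm_sgn)
  moreover have "Kstar x p v = norm v * Kstar x p (sgn v)"
    using False by (subst Kstar_scaleR [symmetric]) (auto simp: sgn_div_norm)
  ultimately show ?thesis
    by (simp add: abs_mult mult_left_le)
qed

lemma stratum_subset_flat: "stratum x \<pi> J \<subseteq> flat x J"
  by (auto simp: stratum_def flat_def)

lemma stratum_subset_closure: "stratum x \<pi> J \<subseteq> stratum_closure x \<pi> J"
  unfolding stratum_closure_def
  by (intro closure_of_subset) (simp add: stratum_subset_flat)

text \<open>Strict inequalities become weak in the closure, since each closed half-space containing
  the stratum also contains its closure.\<close>

lemma stratum_closureD: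
  assumes "v \<in> stratum_closure x \<pi> J"
  shows "v \<in> flat x J" and "j \<in> J \<Longrightarrow> (if \<pi> j then v \<bullet> x j \<ge> 0 else v \<bullet> x j \<le> 0)"
proof -
  show "v \<in> flat x J"
    using assms closure_of_subset_topspace [of "top_of_set (flat x J)"]
    by (auto simp: stratum_closure_def)
  have v: "v \<in> closure (stratum x \<pi> J)"
    using assms stratum_subset_flat [of x \<pi> J]
    by (auto simp: stratum_closure_def closure_of_subtopology Int_absorb1)
  assume j: "j \<in> J"
  define H where "H = (if \<pi> j then {u. x j \<bullet> u \<ge> 0} else {u. x j \<bullet> u \<le> 0})"
  have "closed H"
    by (simp add: H_def closed_halfspace_ge closed_halfspace_le)
  moreover have "stratum x \<pi> J \<subseteq> halfspace x (\<pi> j) j"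
    using j by (auto simp: stratum_def)
  moreover have "halfspace x (\<pi> j) j \<subseteq> H"
    by (auto simp: halfspace_def H_def inner_commute)
  ultimately have "v \<in> H"
    using v closure_minimal [of "stratum x \<pi> J" H] by blast
  then show "if \<pi> j then v \<bullet> x j \<ge> 0 else v \<bullet> x j \<le> 0"
    by (simp add: H_def inner_commute split: if_splits)
qed

lemma Kstar_stratum_closure:
  assumes "v \<in> stratum_closure x \<pi> J"
  shows "Kstar x p v = (\<Sum>i\<in>J. (p $ i * of_bool (\<pi> i)) *\<^sub>R x i) \<bullet> v"
proof -
  have "Kstar x p v = (\<Sum>i\<in>J. p $ i * relu (v \<bullet> x i))"
    unfolding Kstar_def using stratum_closureD(1) [OF assms]
    by (intro sum.mono_neutral_right) (auto simp: flat_def hyperplane_def relu_def)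
  \<comment> \<open>On each weak side of a hyperplane \<open>relu\<close> is the identity or zero;
    on the hyperplane both formulas give 0, so boundary points need no separate case.\<close>
  also have "\<dots> = (\<Sum>i\<in>J. (p $ i * of_bool (\<pi> i)) * (x i \<bullet> v))"
    using stratum_closureD(2) [OF assms]
    by (intro sum.cong) (force simp: relu_def inner_commute split: if_splits)+
  finally show ?thesis
    by (simp add: inner_sum_left)
qed

text \<open>The stratum is a finite intersection of open half-spaces cut with a subspace: openness
  tolerates a small move, and the subspace absorbs moves along itself.\<close>

lemma stratum_translate:
  fixes x :: "'n::finite \<Rightarrow> real ^ 'd::finite"
  assumes w: "w \<in> stratum x \<pi> J" and u: "u \<in> flat x J"
  obtains t where "t > 0" "w + t *\<^sub>R u \<in> stratum x \<pi> J"
proof -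
  define U where "U = (\<Inter>j\<in>J. halfspace x (\<pi> j) j)"
  have eq: "stratum x \<pi> J = U \<inter> flat x J"
    by (auto simp: stratum_def flat_def U_def)
  have "open U"
    unfolding U_def halfspace_def
    using open_halfspace_gt [of 0 "x _"] open_halfspace_lt [of "x _" 0]
    by (intro open_INT) (simp_all add: inner_commute)
  moreover have "((\<lambda>t. w + t *\<^sub>R u) \<longlongrightarrow> w + 0 *\<^sub>R u) (at_right 0)"
    by (intro tendsto_intros)
  ultimately have "\<forall>\<^sub>F t in at_right 0. w + t *\<^sub>R u \<in> U"
    using w by (intro topological_tendstoD) (auto simp: eq)
  then have "\<forall>\<^sub>F t in at_right 0. t > 0 \<and> w + t *\<^sub>R u \<in> U"
    using eventually_at_right_less [of "0::real"] by eventually_elim simp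
  then obtain t where t: "t > 0" "w + t *\<^sub>R u \<in> U"
    by (metis (no_types, lifting) eventually_happens' trivial_limit_at_right_real)
  have "w + t *\<^sub>R u \<in> flat x J"
    using w u by (intro subspace_add subspace_mul subspace_flat) (auto simp: eq)
  with t show thesis
    by (intro that [of t]) (auto simp: eq)
qed

text \<open>Moving along \<open>a\<close> raises the linear functional at rate
  \<open>a \<bullet> a\<close> but the norm only at rate 1 to first order, so the last hypothesis
  limits the length of \<open>a\<close>.\<close>

lemma maximizer_eq:
  fixes a w :: "'a::real_inner"
  assumes "norm w = 1" "a \<bullet> w = 1" "t > 0" "a \<bullet> (w + t *\<^sub>R a) \<le> norm (w + t *\<^sub>R a)"
  shows "w = a"
proof -
  define N where "N = a \<bullet> a"
  have N0: "N \<ge> 0" by (simp add: N_def)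
  have ww: "w \<bullet> w = 1" using assms(1) by (simp add: norm_eq_1)
  have "1 + t * N \<le> norm (w + t *\<^sub>R a)"
    using assms(2,4) by (simp add: inner_add_right N_def)
  then have "(1 + t * N)\<^sup>2 \<le> (norm (w + t *\<^sub>R a))\<^sup>2"
    using N0 \<open>t > 0\<close> by (intro power_mono) auto
  also have "\<dots> = 1 + 2 * t + t\<^sup>2 * N"
    using ww assms(2) unfolding power2_norm_eq_inner
    by (simp add: inner_simps N_def inner_commute power2_eq_square)
  \<comment> \<open>The difference of the two squared sides factors, and only \<open>N - 1\<close>
    can fail to be positive.\<close>
  finally have "t * ((N - 1) * (2 + t * N)) \<le> 0"
    by (simp add: power2_eq_square algebra_simps)
  moreover have "0 < 2 + t * N"
    using N0 \<open>t > 0\<close> by (simp add: add_pos_nonneg)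
  ultimately have "N \<le> 1"
    using \<open>t > 0\<close> by (simp add: mult_le_0_iff)
  \<comment> \<open>Expanding the square gives \<open>1 - 2 + N\<close>.\<close>
  then have "(w - a) \<bullet> (w - a) \<le> 0"
    using ww assms(2) by (simp add: inner_simps inner_commute N_def)
  then have "(w - a) \<bullet> (w - a) = 0"
    using inner_ge_zero by (rule order_antisym)
  then show ?thesis
    by simp
qed

theorem lemma3p9:
  fixes x :: "'n::finite \<Rightarrow> real ^ 'd::finite"
    and y0 \<zeta> p :: "real ^ 'n"
    and lam :: real
    and \<pi> :: "'n \<Rightarrow> bool"
    and J :: "'n set"
    and \<eta> :: "real ^ 'd \<Rightarrow> real"
    and z zt w :: "real ^ 'd"
  assumes "\<And>i. x i \<noteq> 0"
    and "lam > 0"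
    and "dual_solution x (y0 + \<zeta>) lam p"
    and "\<eta> = Kstar x p"
    and "z = (\<Sum>i\<in>J. (p $ i * of_bool (\<pi> i)) *\<^sub>R x i)"
    and "zt = orth_proj (flat x J) z"
    and "w \<in> stratum x \<pi> J \<inter> sphere 0 1"
    and "\<bar>\<eta> w\<bar> = 1"
  shows "zt \<noteq> 0 \<and>
         w = sgn (\<eta> w) *\<^sub>R ((1 / norm zt) *\<^sub>R zt) \<and>
         (\<forall>v \<in> (stratum_closure x \<pi> J \<inter> sphere 0 1) - {w}. \<bar>\<eta> v\<bar> < 1)"
proof -
  have bound: "\<bar>\<eta> v\<bar> \<le> norm v" for v
    using assms(3,4) by (simp add: dual_solution_def is_arg_max_def abs_Kstar_le_norm)
  have lin: "\<eta> v = zt \<bullet> v" if "v \<in> stratum_closure x \<pi> J" for v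
    using Kstar_stratum_closure [OF that, of p] stratum_closureD(1) [OF that] assms(4-6)
      inner_orth_proj [OF subspace_flat, of v x J z] by simp
  have w: "w \<in> stratum x \<pi> J" and nw: "norm w = 1"
    using assms(7) by auto
  have wc: "w \<in> stratum_closure x \<pi> J"
    using w stratum_subset_closure by blast
  \<comment> \<open>Multiplying by the sign makes the value at \<open>w\<close> equal to 1, so the
    maximum and the minimum are treated together, with \<open>s *\<^sub>R zt\<close> as the vector
    \<open>a\<close> of \<open>maximizer_eq\<close>.\<close>
  define s where "s = sgn (\<eta> w)"
  have s: "s = 1 \<or> s = - 1"
    using assms(8) by (auto simp: s_def sgn_if)
  have sw: "s * \<eta> w = 1"
    using assms(8) by (simp add: s_def sgn_mult_abs sgn_mult_self_eq abs_sgn mult.commute)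
  have ztw: "(s *\<^sub>R zt) \<bullet> w = 1"
    using lin [OF wc] sw by simp
  have "s *\<^sub>R zt \<in> flat x J"
    unfolding assms(6) by (intro subspace_mul orth_proj_in subspace_flat)
  then obtain t where t: "t > 0" "w + t *\<^sub>R s *\<^sub>R zt \<in> stratum x \<pi> J"
    using stratum_translate [OF w] by blast
  have "(s *\<^sub>R zt) \<bullet> (w + t *\<^sub>R s *\<^sub>R zt) = s * \<eta> (w + t *\<^sub>R s *\<^sub>R zt)"
    using lin [OF subsetD [OF stratum_subset_closure t(2)]] by simp
  also have "\<dots> \<le> norm (w + t *\<^sub>R s *\<^sub>R zt)"
    using bound [of "w + t *\<^sub>R s *\<^sub>R zt"] s by auto
  finally have weq: "w = s *\<^sub>R zt"
    using maximizer_eq [OF nw ztw t(1)] by blast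
  have nz: "norm zt = 1"
    using nw weq s by auto
  have "\<bar>\<eta> v\<bar> < 1" if v: "v \<in> stratum_closure x \<pi> J" "norm v = 1" "v \<noteq> w" for v
  proof (rule ccontr)
    assume "\<not> \<bar>\<eta> v\<bar> < 1"
    \<comment> \<open>Equality in Cauchy-Schwarz forces \<open>v\<close> to be parallel to
      \<open>zt\<close>.\<close>
    then have "\<bar>zt \<bullet> v\<bar> = norm zt * norm v"
      using bound [of v] v nz lin by auto
    then have "v = zt \<or> v = - zt"
      unfolding norm_cauchy_schwarz_abs_eq using v(2) nz by auto
    then have vw: "v = - w"
      using weq s v(3) by auto
    show False
    proof (cases "J = {}")
      case True
      then have "z = 0"
        using assms(5) by simp
      then have "\<eta> w = 0"
        using Kstar_stratum_closure [OF wc, of p] assms(4,5) by simp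
      with assms(8) show False by simp
    next
      case False
      then obtain j where j: "j \<in> J" by auto
      \<comment> \<open>Since \<open>w\<close> is strictly on one side of hyperplane
        \<open>j\<close>, \<open>- w\<close> is strictly on the other, which even the weak
        inequality of the closure excludes.\<close>
      then have "w \<in> halfspace x (\<pi> j) j"
        using w by (auto simp: stratum_def)
      with stratum_closureD(2) [OF v(1) j] vw show False
        by (auto simp: halfspace_def split: if_splits)
    qed
  qed
  then have "\<forall>v \<in> (stratum_closure x \<pi> J \<inter> sphere 0 1) - {w}. \<bar>\<eta> v\<bar> < 1"
    by simp
  moreover have "w = sgn (\<eta> w) *\<^sub>R ((1 / norm zt) *\<^sub>R zt)"
    unfolding s_def [symmetric] nz using weq by simp
  moreover have "zt \<noteq> 0"
    using nz by auto
  ultimately show ?thesis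
    by (intro conjI)
qed

end
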